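(* Let $(V,q)$ be a Minkowski space whose dimension is greater than $3$, and let $\phi:V\to V$ be a continuous coherency preserver. Then either $\phi$ preserves adjacency, or $\phi$ is degenerate.
   Context: A Minkowski space is a pair $(V,q)$ where $V$ is a finite-dimensional real vector space of dimension $n>1$ and $q$ is a quadratic form on $V$ of signature $(1,n-1)$; $V$ carries its standard topology. Two points $x,y\in V$ are coherent when $q(x-y)=0$, and adjacent when they are coherent and $x\neq y$. For $a\in V$, the coherency cone of $a$ is $\mathcal{C}(a)=\{m\in V: q(m-a)=0\}$. A coherency preserver is a map $\phi:V\to V$ such that whenever $a,b$ are coherent, $\phi(a),\phi(b)$ are coherent; it is degenerate when its range is included in some coherency cone. A map preserves adjacency when it maps every pair of adjacent points to a pair of adjacent points. *)

theory Defs
  imports "HOL-Analysis.Analysis"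
begin

definition quadratic_form :: "('a::real_vector \<Rightarrow> real) \<Rightarrow> bool" where
  "quadratic_form q \<longleftrightarrow>
     (\<exists>B. bilinear B \<and> (\<forall>x y. B x y = B y x) \<and> (\<forall>x. q x = B x x))"

definition has_signature_1_nm1 :: "('a::euclidean_space \<Rightarrow> real) \<Rightarrow> bool" where
  "has_signature_1_nm1 q \<longleftrightarrow>
     (\<exists>e :: nat \<Rightarrow> 'a.
        inj_on e {..<DIM('a)} \<and> independent (e ` {..<DIM('a)}) \<and> span (e ` {..<DIM('a)}) = UNIV \<and>
        (\<forall>c :: nat \<Rightarrow> real.
           q (\<Sum>i<DIM('a). c i *\<^sub>R e i) = (c 0)\<^sup>2 - (\<Sum>i\<in>{1..<DIM('a)}. (c i)\<^sup>2)))"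

definition minkowski_space :: "('a::euclidean_space \<Rightarrow> real) \<Rightarrow> bool" where
  "minkowski_space q \<longleftrightarrow> DIM('a) > 1 \<and> quadratic_form q \<and> has_signature_1_nm1 q"

definition coherent :: "('a::real_vector \<Rightarrow> real) \<Rightarrow> 'a \<Rightarrow> 'a \<Rightarrow> bool" where
  "coherent q x y \<longleftrightarrow> q (x - y) = 0"

definition adjacent :: "('a::real_vector \<Rightarrow> real) \<Rightarrow> 'a \<Rightarrow> 'a \<Rightarrow> bool" where
  "adjacent q x y \<longleftrightarrow> coherent q x y \<and> x \<noteq> y"

definition coherency_cone :: "('a::real_vector \<Rightarrow> real) \<Rightarrow> 'a \<Rightarrow> 'a set" where
  "coherency_cone q a = {m. q (m - a) = 0}"

definition coherency_preserver :: "('a::real_vector \<Rightarrow> real) \<Rightarrow> ('a \<Rightarrow> 'a) \<Rightarrow> bool" where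
  "coherency_preserver q \<phi> \<longleftrightarrow> (\<forall>a b. coherent q a b \<longrightarrow> coherent q (\<phi> a) (\<phi> b))"

definition degenerate :: "('a::real_vector \<Rightarrow> real) \<Rightarrow> ('a \<Rightarrow> 'a) \<Rightarrow> bool" where
  "degenerate q \<phi> \<longleftrightarrow> (\<exists>a. range \<phi> \<subseteq> coherency_cone q a)"

definition preserves_adjacency :: "('a::real_vector \<Rightarrow> real) \<Rightarrow> ('a \<Rightarrow> 'a) \<Rightarrow> bool" where
  "preserves_adjacency q \<phi> \<longleftrightarrow> (\<forall>a b. adjacent q a b \<longrightarrow> adjacent q (\<phi> a) (\<phi> b))"

end

theory Submission
  imports Defs
begin

text \<open>
  Suppose that \<open>\<phi>\<close> collapses two adjacent points; after translations \<open>\<phi> 0 = \<phi> b = 0\<close> with \<open>b\<close> null and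
  nonzero. If \<open>\<phi>\<close> does not map into the cone of \<open>0\<close>, take \<open>x\<close> with \<open>\<phi> x\<close> off that cone. A null line
  through \<open>x\<close> meets the cones of \<open>0\<close> and of \<open>b\<close> in points with the same image, because a null line
  through \<open>\<phi> x\<close> meets the cone of \<open>0\<close> at most once. Points \<open>y\<close>, \<open>z\<close> that are coherent to each other and
  lie on the cones of \<open>0\<close> and \<open>b\<close> respectively have images on one null line through \<open>0\<close>, so two nearby
  points \<open>y\<close>, \<open>y'\<close> on the cones of both \<open>0\<close> and \<open>x\<close> have the same image as soon as some \<open>z\<close> near the
  cone of \<open>x\<close> is coherent to both. Hence \<open>\<phi>\<close> is constant, with value \<open>w\<close> say, on the intersection of
  the cones of \<open>0\<close> and \<open>x\<close>, and it maps the cone of \<open>x\<close> into the null line through \<open>\<phi> x\<close> and \<open>w\<close>. Since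
  any point is coherent to some point of the cone of \<open>x\<close>, the range of \<open>\<phi>\<close> lies in the cone of \<open>w\<close>.
\<close>

section \<open>Solving an equation in one real parameter\<close>

text \<open>For null vectors \<open>v t\<close> whose products \<open>B (v s) (v t)\<close> are a
  fixed positive multiple of \<open>(s - t)\<^sup>2\<close>, the equation says that \<open>\<alpha>
  t0 *\<^sub>R v t0 + s \<tau> *\<^sub>R v \<tau> - \<alpha> t *\<^sub>R v t\<close> is
  null.\<close>

lemma eventually_balanced_parameter:
  fixes \<alpha> s :: "real \<Rightarrow> real"
  assumes \<alpha>: "isCont \<alpha> t0" "\<alpha> t0 \<noteq> 0"
    and I: "open I" "t0 \<in> I" and s: "continuous_on I s" "s t0 \<noteq> 0"
  shows "\<forall>\<^sub>F t in at t0. \<exists>\<tau>\<in>I. \<alpha> t0 * s \<tau> * (t0 - \<tau>)\<^sup>2 - \<alpha> t0 * \<alpha> t * (t0 - t)\<^sup>2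
            - \<alpha> t * s \<tau> * (\<tau> - t)\<^sup>2 = 0"
proof -
  define m where "m = \<alpha> t0 * s t0"
  \<comment> \<open>With \<open>\<tau> = t0 + k (t - t0)\<close> the equation divided by \<open>(t - t0)\<^sup>2\<close> tends to one that is linear in \<open>k\<close>,
     with root \<open>k0\<close>.\<close>
  define k0 where "k0 = (1 + \<alpha> t0 / s t0) / 2"
  \<comment> \<open>The factor \<open>m\<close> gives the limit the positive slope
    \<open>2 * m\<^sup>2\<close> in \<open>k\<close>, whatever the signs of
    \<open>\<alpha> t0\<close> and \<open>s t0\<close>.\<close>
  define H where "H t k = m * (\<alpha> t0 * s (t0 + k * (t - t0)) * k\<^sup>2 - \<alpha> t0 * \<alpha> t
      - \<alpha> t * s (t0 + k * (t - t0)) * (k - 1)\<^sup>2)" for t k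
  have m: "m\<^sup>2 > 0" using \<alpha> s by (simp add: m_def)
  have lim: "((\<lambda>t. H t k) \<longlongrightarrow> 2 * (k - k0) * m\<^sup>2) (at t0)" for k
  proof -
    have "isCont s t0" using s I by (simp add: continuous_on_eq_continuous_at)
    moreover have "((\<lambda>t. t0 + k * (t - t0)) \<longlongrightarrow> t0 + k * (t0 - t0)) (at t0)" by (intro tendsto_intros)
    ultimately have "((\<lambda>t. s (t0 + k * (t - t0))) \<longlongrightarrow> s t0) (at t0)"
      by (intro isCont_tendsto_compose[of _ s]) simp_all
    moreover have "(\<alpha> \<longlongrightarrow> \<alpha> t0) (at t0)" using \<alpha>(1) by (simp add: isCont_def)
    ultimately have "((\<lambda>t. H t k) \<longlongrightarrow> m * (\<alpha> t0 * s t0 * k\<^sup>2 - \<alpha> t0 * \<alpha> t0 - \<alpha> t0 * s t0 * (k - 1)\<^sup>2)) (at t0)"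
      unfolding H_def by (intro tendsto_intros)
    moreover have "m * (\<alpha> t0 * s t0 * k\<^sup>2 - \<alpha> t0 * \<alpha> t0 - \<alpha> t0 * s t0 * (k - 1)\<^sup>2) = 2 * (k - k0) * m\<^sup>2"
      using s(2) unfolding m_def k0_def by (simp add: field_simps power2_eq_square)
    ultimately show ?thesis by simp
  qed
  have "\<forall>\<^sub>F t in at t0. H t (k0 + 1) > 0" using lim[of "k0 + 1"] m by (intro order_tendstoD(1)) auto
  moreover have "\<forall>\<^sub>F t in at t0. H t (k0 - 1) < 0" using lim[of "k0 - 1"] m by (intro order_tendstoD(2)) auto
  moreover obtain d where d: "d > 0" "ball t0 d \<subseteq> I" using I openE by blast
  have "\<forall>\<^sub>F t in at t0. \<bar>t - t0\<bar> < d / (\<bar>k0\<bar> + 1)"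
    unfolding eventually_at using d(1) by (intro exI[of _ "d / (\<bar>k0\<bar> + 1)"]) (auto simp: dist_real_def)
  ultimately show ?thesis
  proof eventually_elim
    case (elim t)
    have inI: "t0 + k * (t - t0) \<in> I" if "k \<in> {k0 - 1..k0 + 1}" for k
    proof -
      have "\<bar>k\<bar> \<le> \<bar>k0\<bar> + 1" using that by auto
      hence "\<bar>k * (t - t0)\<bar> \<le> (\<bar>k0\<bar> + 1) * \<bar>t - t0\<bar>" by (simp add: abs_mult mult_right_mono)
      also have "\<dots> < d" using elim(3) by (simp add: pos_less_divide_eq mult.commute)
      finally show ?thesis using d(2) by (auto simp: subset_iff dist_real_def)
    qed
    have "continuous_on {k0 - 1..k0 + 1} (\<lambda>k. s (t0 + k * (t - t0)))"
      by (rule continuous_on_compose2[OF s(1)]) (use inI in \<open>auto intro!: continuous_intros\<close>)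
    hence "continuous_on {k0 - 1..k0 + 1} (H t)"
      unfolding H_def by (intro continuous_intros)
    then obtain k where k: "k \<in> {k0 - 1..k0 + 1}" "H t k = 0"
      using IVT'[of "H t" "k0 - 1" 0 "k0 + 1"] elim by auto
    define \<tau> where "\<tau> = t0 + k * (t - t0)"
    have eq: "\<alpha> t0 * s \<tau> * k\<^sup>2 - \<alpha> t0 * \<alpha> t - \<alpha> t * s \<tau> * (k - 1)\<^sup>2 = 0"
      using k(2) m unfolding H_def \<tau>_def by auto
    have "\<alpha> t0 * s \<tau> * (t0 - \<tau>)\<^sup>2 - \<alpha> t0 * \<alpha> t * (t0 - t)\<^sup>2 - \<alpha> t * s \<tau> * (\<tau> - t)\<^sup>2
        = (t - t0)\<^sup>2 * (\<alpha> t0 * s \<tau> * k\<^sup>2 - \<alpha> t0 * \<alpha> t - \<alpha> t * s \<tau> * (k - 1)\<^sup>2)"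
    proof -
      have "(t0 - \<tau>)\<^sup>2 = (t - t0)\<^sup>2 * k\<^sup>2" "(\<tau> - t)\<^sup>2 = (t - t0)\<^sup>2 * (k - 1)\<^sup>2" "(t0 - t)\<^sup>2 = (t - t0)\<^sup>2"
        by (simp_all add: \<tau>_def power2_eq_square algebra_simps)
      thus ?thesis by (simp add: algebra_simps)
    qed
    moreover have "\<tau> \<in> I" using inI[OF k(1)] by (simp add: \<tau>_def)
    ultimately show ?case using eq by auto
  qed
qed

section \<open>Lorentz forms and their null vectors\<close>

text \<open>A coordinate-free form of the signature: \<open>e0\<close> is a time direction and
  \<open>B e0 x\<close> the time component of \<open>x\<close>.\<close>

locale lorentz_form =
  fixes B :: "'a::euclidean_space \<Rightarrow> 'a \<Rightarrow> real" and e0 :: 'a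
  assumes bil: "bilinear B"
    and sym: "B x y = B y x"
    and unit: "B e0 e0 = 1"
    and neg: "B e0 x = 0 \<Longrightarrow> x \<noteq> 0 \<Longrightarrow> B x x < 0"
    and dim: "2 < DIM('a)"
begin

lemmas expand = bilinear_ladd[OF bil] bilinear_radd[OF bil] bilinear_lsub[OF bil]
  bilinear_rsub[OF bil] bilinear_lmul[OF bil] bilinear_rmul[OF bil]
  bilinear_lneg[OF bil] bilinear_rneg[OF bil] bilinear_lzero[OF bil] bilinear_rzero[OF bil]

lemma B_diff: "B (x - y) (x - y) = B x x - 2 * B x y + B y y"
  using sym[of x y] by (simp add: expand)

lemma B_add: "B (x + y) (x + y) = B x x + 2 * B x y + B y y"
  using sym[of x y] by (simp add: expand)

lemma B_diff_commute: "B (x - y) (x - y) = B (y - x) (y - x)"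
  by (simp add: B_diff sym[of x y])

lemma continuous_on_B [continuous_intros]:
  "continuous_on S f \<Longrightarrow> continuous_on S g \<Longrightarrow> continuous_on S (\<lambda>t. B (f t) (g t))"
  using bil bilinear_conv_bounded_bilinear bounded_bilinear.continuous_on by blast

lemma nonpos: "B e0 x = 0 \<Longrightarrow> B x x \<le> 0"
  using neg[of x] by (cases "x = 0") (auto simp: expand)

lemma null_time_nonzero: "B x x = 0 \<Longrightarrow> x \<noteq> 0 \<Longrightarrow> B e0 x \<noteq> 0"
  using neg by fastforce

text \<open>The combination of \<open>x\<close> and \<open>y\<close> without time component is null,
  hence zero.\<close>

lemma null_orthogonal_parallel:
  assumes "B x x = 0" "B y y = 0" "B x y = 0" "x \<noteq> 0"
  obtains c where "y = c *\<^sub>R x"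
proof -
  define z where "z = B e0 y *\<^sub>R x - B e0 x *\<^sub>R y"
  have "B e0 z = 0" by (simp add: z_def expand)
  moreover have "B z z = 0" unfolding z_def B_diff using assms by (simp add: expand)
  ultimately have "z = 0" using neg by fastforce
  hence "B e0 x *\<^sub>R y = B e0 y *\<^sub>R x" by (simp add: z_def)
  moreover have "B e0 x \<noteq> 0" using null_time_nonzero assms by blast
  ultimately have "y = (B e0 y / B e0 x) *\<^sub>R x"
    by (metis divideR_right divide_inverse_commute scaleR_scaleR)
  thus ?thesis by (rule that)
qed

text \<open>Eliminating the time component between \<open>x\<close> and \<open>u\<close> gives a
  vector whose square is nonpositive and, by orthogonality, splits into a multiple of
  \<open>B x x\<close> and a positive multiple of \<open>B u u\<close>.\<close>

lemma timelike_orthogonal: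
  assumes u: "B u u > 0" and "B u x = 0" "x \<noteq> 0"
  shows "B x x < 0"
proof (cases "B e0 x = 0")
  case False
  have Tu: "B e0 u \<noteq> 0" using nonpos[of u] u by auto
  define y where "y = B e0 u *\<^sub>R x - B e0 x *\<^sub>R u"
  have "B e0 y = 0" by (simp add: y_def expand)
  hence "B y y \<le> 0" by (rule nonpos)
  moreover have "B y y = (B e0 u)\<^sup>2 * B x x + (B e0 x)\<^sup>2 * B u u"
    unfolding y_def B_diff using assms sym[of u x] by (simp add: expand power2_eq_square)
  moreover have "(B e0 x)\<^sup>2 * B u u > 0" using False u by simp
  ultimately have "(B e0 u)\<^sup>2 * B x x < 0" by linarith
  thus ?thesis by (simp add: mult_less_0_iff)
qed (use neg assms in auto)

lemma orthogonal_pair_exists: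
  obtains e where "e \<noteq> 0" "B p e = 0" "B r e = 0"
proof -
  have lin: "linear (B a)" for a using bil by (simp add: bilinear_def)
  \<comment> \<open>\<open>f a\<close> represents the functional \<open>B a\<close> in the inner
    product, so two vectors must be avoided in dimension at least three.\<close>
  define f where "f a = adjoint (B a) 1" for a
  have f: "x \<bullet> f a = B a x" for a x
    using adjoint_works[OF lin, of x a 1] by (simp add: f_def)
  have "dim {f p, f r} \<le> card {f p, f r}"
    by (rule dim_le_card) (auto intro: span_base)
  also have "\<dots> \<le> 2" by (simp add: card_insert_if)
  finally have "dim {f p, f r} < DIM('a)" using dim by simp
  then obtain e where e: "e \<noteq> 0" "\<And>y. y \<in> span {f p, f r} \<Longrightarrow> orthogonal e y"
    by (rule orthogonal_to_subspace_exists) blast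
  have "orthogonal e (f p)" "orthogonal e (f r)" by (auto intro!: e span_base)
  thus ?thesis using that e(1) f by (simp add: orthogonal_def)
qed

lemma null_same_time_sign:
  assumes "B p p = 0" "B r r = 0" "B p r \<noteq> 0"
  shows "B e0 p * B e0 r * B p r > 0"
proof -
  define z where "z = B e0 r *\<^sub>R p - B e0 p *\<^sub>R r"
  have "B e0 z = 0" by (simp add: z_def expand)
  hence "B z z \<le> 0" by (rule nonpos)
  moreover have "B z z = - 2 * (B e0 p * B e0 r * B p r)"
    unfolding z_def B_diff using assms by (simp add: expand)
  moreover have "p \<noteq> 0" "r \<noteq> 0" using assms(3) by (auto simp: expand)
  hence "B e0 p \<noteq> 0" "B e0 r \<noteq> 0"
    using null_time_nonzero assms(1,2) \<open>p \<noteq> 0\<close> \<open>r \<noteq> 0\<close> by blast+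
  ultimately show ?thesis using assms(3)
    by (smt (verit) mult_eq_0_iff)
qed

text \<open>Multiplying the three instances of \<open>null_same_time_sign\<close>, each time
  component occurs twice and the signs cancel.\<close>

lemma null_triple_product_nonneg:
  assumes "B p p = 0" "B r r = 0" "B b b = 0"
  shows "B p r * B p b * B r b \<ge> 0"
proof (cases "B p r = 0 \<or> B p b = 0 \<or> B r b = 0")
  case False
  hence "B e0 p * B e0 r * B p r > 0" "B e0 p * B e0 b * B p b > 0" "B e0 r * B e0 b * B r b > 0"
    using null_same_time_sign assms by auto
  hence "(B e0 p * B e0 r * B p r) * (B e0 p * B e0 b * B p b) * (B e0 r * B e0 b * B r b) > 0"
    by simp
  also have "(B e0 p * B e0 r * B p r) * (B e0 p * B e0 b * B p b) * (B e0 r * B e0 b * B r b)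
    = (B e0 p * B e0 r * B e0 b)\<^sup>2 * (B p r * B p b * B r b)"
    by (simp add: power2_eq_square)
  finally show ?thesis by (metis zero_less_mult_iff not_less zero_le_power2 less_imp_le)
qed auto

text \<open>The null vectors \<open>s *\<^sub>R e0 + x\<close> and \<open>s *\<^sub>R e0 - x\<close>
  span \<open>e0\<close> and \<open>x\<close>, so a vector orthogonal to all null vectors is
  orthogonal to \<open>e0\<close> and then to itself.\<close>

lemma null_not_orthogonal_exists:
  assumes "a \<noteq> 0"
  obtains r where "B r r = 0" "B a r \<noteq> 0"
proof -
  have False if all: "\<And>r. B r r = 0 \<Longrightarrow> B a r = 0"
  proof -
    have *: "B a e0 = 0 \<and> B a x = 0" if x: "B e0 x = 0" "x \<noteq> 0" for x
    proof -
      define s where "s = sqrt (- B x x)"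
      have s: "s > 0" "s * s = - B x x" using neg[OF x] by (auto simp: s_def)
      have "B (s *\<^sub>R e0 + x) (s *\<^sub>R e0 + x) = 0" "B (s *\<^sub>R e0 - x) (s *\<^sub>R e0 - x) = 0"
        unfolding B_add B_diff using x s unit by (simp_all add: expand)
      hence "B a (s *\<^sub>R e0 + x) = 0" "B a (s *\<^sub>R e0 - x) = 0" using all by auto
      hence "s * B a e0 + B a x = 0" "s * B a e0 - B a x = 0" by (simp_all add: expand)
      hence "s * B a e0 = 0" "B a x = 0" by auto
      thus ?thesis using s by simp
    qed
    obtain x where "x \<noteq> 0" "B e0 x = 0" using orthogonal_pair_exists by metis
    hence "B a e0 = 0" using * by blast
    hence "B e0 a = 0" using sym by metis
    hence "B a a = 0" using * assms by blast
    thus False using neg \<open>B e0 a = 0\<close> assms by fastforce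
  qed
  thus ?thesis using that by blast
qed

section \<open>Arcs of conics in the null cone\<close>

definition null_arc :: "'a \<Rightarrow> 'a \<Rightarrow> 'a \<Rightarrow> real \<Rightarrow> 'a" where
  "null_arc p e r t = (1 - t)\<^sup>2 *\<^sub>R p + (t * (1 - t)) *\<^sub>R e + t\<^sup>2 *\<^sub>R r"

text \<open>The value of \<open>B e e\<close> is the one that makes the whole arc from
  \<open>p\<close> to \<open>r\<close> null.\<close>

definition arc_frame :: "'a \<Rightarrow> 'a \<Rightarrow> 'a \<Rightarrow> bool" where
  "arc_frame p e r \<longleftrightarrow> B p p = 0 \<and> B r r = 0 \<and> B p r > 0 \<and> B p e = 0 \<and> B r e = 0
     \<and> B e e = - 2 * B p r"

lemma null_arc_ends [simp]: "null_arc p e r 0 = p" "null_arc p e r 1 = r"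
  by (simp_all add: null_arc_def)

lemma continuous_on_null_arc [continuous_intros]: "continuous_on S (null_arc p e r)"
  unfolding null_arc_def by (intro continuous_intros)

lemma B_null_arc:
  "B a (null_arc p e r t) = (1 - t)\<^sup>2 * B a p + t * (1 - t) * B a e + t\<^sup>2 * B a r"
  by (simp add: null_arc_def expand)

text \<open>This turns coherence between points reached along directions of the arc into scalar
  equations in the parameters.\<close>

lemma null_arc_product:
  assumes "arc_frame p e r"
  shows "B (null_arc p e r s) (null_arc p e r t) = B p r * (s - t)\<^sup>2"
proof -
  have "B (null_arc p e r s) p = s\<^sup>2 * B p r" "B (null_arc p e r s) r = (1 - s)\<^sup>2 * B p r"
    "B (null_arc p e r s) e = s * (1 - s) * (- 2 * B p r)"
    using assms unfolding sym[of "null_arc p e r s"] B_null_arc arc_frame_def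
    by (simp_all add: sym[of e p] sym[of e r] sym[of r p])
  hence "B (null_arc p e r s) (null_arc p e r t) =
      (1 - t)\<^sup>2 * (s\<^sup>2 * B p r) + t * (1 - t) * (s * (1 - s) * (- 2 * B p r)) + t\<^sup>2 * ((1 - s)\<^sup>2 * B p r)"
    by (simp only: B_null_arc)
  also have "\<dots> = B p r * (s - t)\<^sup>2"
    by (simp add: algebra_simps power2_eq_square)
  finally show ?thesis .
qed

lemma null_arc_null: "arc_frame p e r \<Longrightarrow> B (null_arc p e r t) (null_arc p e r t) = 0"
  by (simp add: null_arc_product)

text \<open>As \<open>p + r\<close> is timelike, a common orthogonal vector is spacelike and can be
  rescaled; its sign remains free and serves the second conclusion.\<close>

lemma arc_frame_exists:
  assumes "B p p = 0" "B r r = 0" "B p r > 0"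
  obtains e where "arc_frame p e r" "0 \<le> c * B a e"
proof -
  obtain e where e: "e \<noteq> 0" "B p e = 0" "B r e = 0" by (rule orthogonal_pair_exists)
  have "B (p + r) (p + r) > 0" using assms by (simp add: B_add)
  moreover have "B (p + r) e = 0" using e by (simp add: expand)
  ultimately have ne: "B e e < 0" using timelike_orthogonal e(1) by blast
  define k where "k = sqrt (2 * B p r / - B e e)"
  have "k * k = 2 * B p r / - B e e" using ne assms(3) by (simp add: k_def divide_nonneg_neg)
  hence k: "k * (k * B e e) = - 2 * B p r" using ne by (simp add: field_simps)
  have fr: "arc_frame p (k *\<^sub>R e) r" "arc_frame p (- (k *\<^sub>R e)) r"
    using assms e k by (simp_all add: arc_frame_def expand)
  show ?thesis
  proof (cases "0 \<le> c * B a (k *\<^sub>R e)")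
    case True thus ?thesis using that fr by blast
  next
    case False
    hence "0 \<le> c * B a (- (k *\<^sub>R e))" by (simp add: expand)
    thus ?thesis using that fr by blast
  qed
qed

lemma null_arc_same_sign_nonzero:
  assumes "B a p * B a r \<ge> 0" "B a r \<noteq> 0" "0 \<le> B a r * B a e" "0 < t" "t \<le> 1"
  shows "B a (null_arc p e r t) \<noteq> 0"
proof -
  have "B a r * B a (null_arc p e r t) =
      (1 - t)\<^sup>2 * (B a p * B a r) + t * (1 - t) * (B a r * B a e) + t\<^sup>2 * (B a r)\<^sup>2"
    by (simp add: B_null_arc algebra_simps power2_eq_square)
  moreover have "t\<^sup>2 * (B a r)\<^sup>2 > 0" using assms by simp
  moreover have "(1 - t)\<^sup>2 * (B a p * B a r) \<ge> 0" using assms by simp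
  moreover have "t * (1 - t) * (B a r * B a e) \<ge> 0" using assms by simp
  ultimately show ?thesis by (metis add_nonneg_nonneg add_nonneg_pos less_irrefl mult_zero_right)
qed

text \<open>A ray (if \<open>v = 0\<close>) or a null arc leads from \<open>v\<close> to a null
  vector off the hyperplane orthogonal to \<open>a\<close>, and leaves that hyperplane at
  once.\<close>

lemma null_dense:
  assumes "open U" "v \<in> U" "B v v = 0" "a \<noteq> 0"
  obtains v' where "v' \<in> U" "B v' v' = 0" "B a v' \<noteq> 0"
proof (cases "B a v = 0")
  case True
  obtain r0 where r0: "B r0 r0 = 0" "B a r0 \<noteq> 0" using null_not_orthogonal_exists assms(4) by blast
  have "\<exists>f. continuous_on {0..1} f \<and> f (0::real) = v \<and>
          (\<forall>t\<in>{0<..1}. B (f t) (f t) = 0 \<and> B a (f t) \<noteq> 0)"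
  proof (cases "v = 0")
    case True
    thus ?thesis using r0
      by (intro exI[of _ "\<lambda>t. t *\<^sub>R r0"]) (auto simp: expand intro!: continuous_intros)
  next
    case False
    have "B v r0 \<noteq> 0"
    proof
      assume "B v r0 = 0"
      then obtain c where "r0 = c *\<^sub>R v" using null_orthogonal_parallel assms(3) r0(1) False by metis
      thus False using r0 True by (simp add: expand)
    qed
    then obtain r where r: "B r r = 0" "B a r \<noteq> 0" "B v r > 0"
      using r0 by (cases "B v r0 > 0") (force simp: expand dest: spec[of _ "- r0"])+
    obtain e where e: "arc_frame v e r" "0 \<le> B a r * B a e"
      using arc_frame_exists assms(3) r by metis
    show ?thesis
      using e r True null_arc_null null_arc_same_sign_nonzero[of a v r e]
      by (intro exI[of _ "null_arc v e r"]) (auto intro: continuous_intros)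
  qed
  then obtain f where f: "continuous_on {0..1} f" "f (0::real) = v"
    "\<And>t. t \<in> {0<..1} \<Longrightarrow> B (f t) (f t) = 0 \<and> B a (f t) \<noteq> 0" by blast
  have "(f \<longlongrightarrow> v) (at 0 within {0..1})" using f(1,2) by (auto simp: continuous_on_def)
  hence "\<forall>\<^sub>F t in at 0 within {0..1}. f t \<in> U" using assms by (simp add: topological_tendstoD)
  then obtain d where d: "d > 0" "\<And>t. t \<in> {0..1} \<Longrightarrow> t \<noteq> 0 \<Longrightarrow> dist t 0 < d \<Longrightarrow> f t \<in> U"
    by (auto simp: eventually_at)
  have "f (min 1 (d/2)) \<in> U" using d(1) by (intro d(2)) auto
  thus ?thesis using that f(3)[of "min 1 (d/2)"] d(1) by auto
qed (use assms that in blast)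

lemma null_arc_roots_finite:
  assumes "B a p \<noteq> 0"
  shows "finite {t. B a (null_arc p e r t) = 0}"
proof -
  define f where "f = [:B a p, B a e - 2 * B a p, B a p - B a e + B a r:]"
  have "B a (null_arc p e r t) = poly f t" for t
    by (simp add: f_def B_null_arc algebra_simps power2_eq_square)
  moreover have "f \<noteq> 0" using assms by (simp add: f_def)
  ultimately show ?thesis using poly_roots_finite[of f] by simp
qed

section \<open>Null lines meeting cones\<close>

text \<open>Here \<open>w\<close> and \<open>w'\<close> are orthogonal null vectors, hence parallel,
  and \<open>B u u = 2 * B u w = 2 * B u w'\<close> fixes the factor.\<close>

lemma null_line_meets_cone_once:
  assumes "B u u \<noteq> 0" "B w w = 0" "B w' w' = 0"
    "B (u - w) (u - w) = 0" "B (u - w') (u - w') = 0" "B (w - w') (w - w') = 0"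
  shows "w = w'"
proof -
  have "w \<noteq> 0" using assms by auto
  moreover have "B w w' = 0" using assms by (simp add: B_diff)
  ultimately obtain c where c: "w' = c *\<^sub>R w" using null_orthogonal_parallel assms by metis
  have "B u u = 2 * B u w" "B u u = 2 * (c * B u w)" using assms sym[of w u] by (auto simp: c expand)
  hence "c = 1" using assms(1) by simp
  thus ?thesis using c by simp
qed

text \<open>The intersection of the cone of \<open>c\<close> with the line through \<open>x\<close>
  in the null direction \<open>v\<close>, along which the form is affine. If \<open>v\<close> is
  orthogonal to \<open>x - c\<close>, division by zero yields \<open>x\<close>.\<close>

definition cone_hit :: "'a \<Rightarrow> 'a \<Rightarrow> 'a \<Rightarrow> 'a" where
  "cone_hit c x v = x - (B (x - c) (x - c) / (2 * B (x - c) v)) *\<^sub>R v"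

lemma cone_hit_on_cone:
  assumes "B v v = 0" "B (x - c) v \<noteq> 0"
  shows "B (cone_hit c x v - c) (cone_hit c x v - c) = 0"
proof -
  define k where "k = B (x - c) (x - c) / (2 * B (x - c) v)"
  have "cone_hit c x v - c = (x - c) - k *\<^sub>R v"
    by (simp add: cone_hit_def k_def algebra_simps)
  moreover have "2 * (k * B (x - c) v) = B (x - c) (x - c)" using assms by (simp add: k_def)
  moreover have "B ((x - c) - k *\<^sub>R v) ((x - c) - k *\<^sub>R v) = B (x - c) (x - c) - 2 * (k * B (x - c) v)"
    using assms(1) by (subst B_diff) (simp add: bilinear_lmul[OF bil] bilinear_rmul[OF bil])
  ultimately show ?thesis by (simp only:)
qed

lemma cone_hit_on_line: "B v v = 0 \<Longrightarrow> B (x + k *\<^sub>R v - cone_hit c x v) (x + k *\<^sub>R v - cone_hit c x v) = 0"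
  by (simp add: cone_hit_def expand B_add)

lemma cone_hit_parallel: "k \<noteq> 0 \<Longrightarrow> cone_hit c x (k *\<^sub>R v) = cone_hit c x v"
  by (simp add: cone_hit_def bilinear_rmul[OF bil])

lemma continuous_on_cone_hit_arc:
  "(\<And>t. t \<in> S \<Longrightarrow> B (x - c) (null_arc p e r t) \<noteq> 0) \<Longrightarrow>
    continuous_on S (\<lambda>t. cone_hit c x (null_arc p e r t))"
  unfolding cone_hit_def by (intro continuous_intros) auto

end

section \<open>Preservers that collapse two adjacent points\<close>

locale collapsing_preserver = lorentz_form B e0
  for B :: "'a::euclidean_space \<Rightarrow> 'a \<Rightarrow> real" and e0 +
  fixes \<phi> :: "'a \<Rightarrow> 'a" and b :: 'a
  assumes cont: "continuous_on UNIV \<phi>"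
    and pres: "B (x - y) (x - y) = 0 \<Longrightarrow> B (\<phi> x - \<phi> y) (\<phi> x - \<phi> y) = 0"
    and phi_0: "\<phi> 0 = 0" and phi_b: "\<phi> b = 0"
    and b_nz: "b \<noteq> 0" and b_null: "B b b = 0"
begin

lemma phi_null: "B y y = 0 \<Longrightarrow> B (\<phi> y) (\<phi> y) = 0"
  using pres[of y 0] phi_0 by simp

lemma phi_null_b: "B (y - b) (y - b) = 0 \<Longrightarrow> B (\<phi> y) (\<phi> y) = 0"
  using pres[of y b] phi_b by simp

lemma continuous_on_phi [continuous_intros]:
  "continuous_on S f \<Longrightarrow> continuous_on S (\<lambda>t. \<phi> (f t))"
  using continuous_on_compose2[OF cont] by blast

text \<open>Both points lie on one null line through \<open>x\<close>, so their images and
  \<open>\<phi> x\<close> are pairwise coherent, while both images lie on the cone of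
  \<open>0\<close>.\<close>

lemma phi_cone_hit_eq:
  assumes "B (\<phi> x) (\<phi> x) \<noteq> 0" "B v v = 0" "B x v \<noteq> 0" "B (x - b) v \<noteq> 0"
  shows "\<phi> (cone_hit 0 x v) = \<phi> (cone_hit b x v)"
proof (rule null_line_meets_cone_once[OF assms(1)])
  show "B (\<phi> (cone_hit 0 x v)) (\<phi> (cone_hit 0 x v)) = 0"
    using cone_hit_on_cone[of v x 0] assms by (intro phi_null) simp
  show "B (\<phi> (cone_hit b x v)) (\<phi> (cone_hit b x v)) = 0"
    using cone_hit_on_cone[of v x b] assms by (intro phi_null_b) simp
  show "B (\<phi> x - \<phi> (cone_hit 0 x v)) (\<phi> x - \<phi> (cone_hit 0 x v)) = 0"
    "B (\<phi> x - \<phi> (cone_hit b x v)) (\<phi> x - \<phi> (cone_hit b x v)) = 0"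
    using cone_hit_on_line[of v x 0] assms(2) by (auto intro!: pres)
  show "B (\<phi> (cone_hit 0 x v) - \<phi> (cone_hit b x v)) (\<phi> (cone_hit 0 x v) - \<phi> (cone_hit b x v)) = 0"
  proof (rule pres)
    define k where "k = - (B x x / (2 * B x v))"
    have "cone_hit 0 x v = x + k *\<^sub>R v" by (simp add: cone_hit_def k_def)
    thus "B (cone_hit 0 x v - cone_hit b x v) (cone_hit 0 x v - cone_hit b x v) = 0"
      using cone_hit_on_line assms(2) by metis
  qed
qed

text \<open>Both images are multiples of the nonzero null vector \<open>\<phi> z\<close>, hence
  coherent to each other and to \<open>\<phi> x\<close>.\<close>

lemma phi_eq_via_common_point:
  assumes x: "B (\<phi> x) (\<phi> x) \<noteq> 0"
    and y: "B y y = 0" "B (x - y) (x - y) = 0" and y': "B y' y' = 0" "B (x - y') (x - y') = 0"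
    and z: "B (z - b) (z - b) = 0" "B (z - y) (z - y) = 0" "B (z - y') (z - y') = 0" "\<phi> z \<noteq> 0"
  shows "\<phi> y = \<phi> y'"
proof (rule null_line_meets_cone_once[OF x])
  show *: "B (\<phi> y) (\<phi> y) = 0" "B (\<phi> y') (\<phi> y') = 0" using phi_null y y' by auto
  show "B (\<phi> x - \<phi> y) (\<phi> x - \<phi> y) = 0" "B (\<phi> x - \<phi> y') (\<phi> x - \<phi> y') = 0"
    using pres y y' by auto
  have z0: "B (\<phi> z) (\<phi> z) = 0" using z phi_null_b by blast
  have "B (\<phi> z) (\<phi> y) = 0" "B (\<phi> z) (\<phi> y') = 0"
    using pres[OF z(2)] pres[OF z(3)] * z0 by (auto simp: B_diff)
  then obtain c c' where "\<phi> y = c *\<^sub>R \<phi> z" "\<phi> y' = c' *\<^sub>R \<phi> z"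
    using null_orthogonal_parallel z0 * z(4) by metis
  thus "B (\<phi> y - \<phi> y') (\<phi> y - \<phi> y') = 0" using z0 by (simp add: expand)
qed

text \<open>The common point is sought on the null lines through the hit \<open>y\<close> at
  \<open>t0\<close>: the direction \<open>v \<tau>\<close> is tuned until the point
  \<open>z \<tau>\<close> on the cone of \<open>b\<close> is also coherent to the hit at
  \<open>t\<close>.\<close>

lemma phi_cone_hit_arc_locally_constant:
  assumes fr: "arc_frame p e r" and x: "B (\<phi> x) (\<phi> x) \<noteq> 0"
  defines "v \<equiv> null_arc p e r"
  assumes x0: "B x (v t0) \<noteq> 0" and xb: "B (x - b) (v t0) \<noteq> 0"
    and yb: "B (cone_hit 0 x (v t0)) b \<noteq> 0"
  shows "\<forall>\<^sub>F t in at t0. \<phi> (cone_hit 0 x (v t)) = \<phi> (cone_hit 0 x (v t0))"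
proof -
  have vv: "B (v s) (v t) = B p r * (s - t)\<^sup>2" for s t
    unfolding v_def by (rule null_arc_product[OF fr])
  have v0: "B (v t) (v t) = 0" for t by (simp add: vv)
  have contv: "continuous_on S v" for S unfolding v_def by (intro continuous_intros)
  have xx: "B x x \<noteq> 0" using x phi_null by blast
  define \<alpha> where "\<alpha> t = - (B x x / (2 * B x (v t)))" for t
  have hit: "cone_hit 0 x (v t) = x + \<alpha> t *\<^sub>R v t" for t by (simp add: cone_hit_def \<alpha>_def)
  define y where "y = cone_hit 0 x (v t0)"
  \<comment> \<open>This solves \<open>B (z \<tau> - b) (z \<tau> - b) = 0\<close>, since
    \<open>B (y - b) (y - b) = - 2 * B y b\<close>.\<close>
  define s where "s \<tau> = B y b / B (y - b) (v \<tau>)" for \<tau>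
  define z where "z \<tau> = y + s \<tau> *\<^sub>R v \<tau>" for \<tau>
  define I0 where "I0 = {\<tau>. B (y - b) (v \<tau>) \<noteq> 0}"
  define I where "I = {\<tau> \<in> I0. \<phi> (z \<tau>) \<noteq> 0}"
  have yy: "B y y = 0" using cone_hit_on_cone[of "v t0" x 0] x0 v0 by (simp add: y_def)
  have xy: "B (x - y) (x - y) = 0" using cone_hit_on_line[of "v t0" x 0 0] v0 by (simp add: y_def)
  have zb: "B (z \<tau> - b) (z \<tau> - b) = 0" if "\<tau> \<in> I0" for \<tau>
  proof -
    have "z \<tau> - b = (y - b) + s \<tau> *\<^sub>R v \<tau>" by (simp add: z_def)
    hence "B (z \<tau> - b) (z \<tau> - b) = B (y - b) (y - b) + 2 * (s \<tau> * B (y - b) (v \<tau>))"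
      using v0 by (simp only: B_add) (simp add: bilinear_rmul[OF bil] bilinear_lmul[OF bil])
    also have "\<dots> = 0" using that yy b_null by (simp add: s_def I0_def B_diff)
    finally show ?thesis .
  qed
  have openI0: "open I0"
    unfolding I0_def by (intro open_Collect_neq continuous_intros contv)
  have conts: "continuous_on I0 s"
    unfolding s_def I0_def by (intro continuous_intros contv) auto
  have "continuous_on I0 (\<lambda>\<tau>. \<phi> (z \<tau>))" unfolding z_def by (intro continuous_intros contv conts)
  hence "open (I0 \<inter> (\<lambda>\<tau>. \<phi> (z \<tau>)) -` (- {0}))"
    using openI0 by (intro continuous_open_preimage) auto
  moreover have "I0 \<inter> (\<lambda>\<tau>. \<phi> (z \<tau>)) -` (- {0}) = I" by (auto simp: I_def)
  ultimately have openI: "open I" by simp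
  have "B (y - b) (v t0) = B (x - b) (v t0)" using v0 unfolding y_def hit by (simp add: expand)
  hence t00: "t0 \<in> I0" using xb by (simp add: I0_def)
  \<comment> \<open>\<open>z t0\<close> lies on the null line through \<open>x\<close> and
    \<open>y\<close>; if its image were \<open>0\<close>, then \<open>\<phi> x\<close> would be
    null.\<close>
  have "B (x - z t0) (x - z t0) = 0" using v0 by (simp add: z_def y_def hit expand B_add)
  hence "B (\<phi> x - \<phi> (z t0)) (\<phi> x - \<phi> (z t0)) = 0" by (rule pres)
  hence t0I: "t0 \<in> I" using t00 x by (auto simp: I_def)
  have "continuous_on {t. B x (v t) \<noteq> 0} \<alpha>" unfolding \<alpha>_def by (intro continuous_intros contv) auto
  moreover have op: "open {t. B x (v t) \<noteq> 0}" by (intro open_Collect_neq continuous_intros contv)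
  ultimately have "isCont \<alpha> t0" using x0 by (simp add: continuous_on_eq_continuous_at)
  moreover have "\<alpha> t0 \<noteq> 0" using xx x0 by (simp add: \<alpha>_def)
  moreover have "s t0 \<noteq> 0" using yb t00 by (simp add: s_def I0_def y_def)
  moreover have "continuous_on I s" using conts by (rule continuous_on_subset) (auto simp: I_def)
  ultimately have "\<forall>\<^sub>F t in at t0. \<exists>\<tau>\<in>I. \<alpha> t0 * s \<tau> * (t0 - \<tau>)\<^sup>2 - \<alpha> t0 * \<alpha> t * (t0 - t)\<^sup>2
            - \<alpha> t * s \<tau> * (\<tau> - t)\<^sup>2 = 0"
    using eventually_balanced_parameter openI t0I by blast
  moreover have "\<forall>\<^sub>F t in at t0. B x (v t) \<noteq> 0"
    using op x0 by (auto simp: eventually_at_topological)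
  ultimately show ?thesis
  proof eventually_elim
    case (elim t)
    then obtain \<tau> where \<tau>: "\<tau> \<in> I" and eq: "\<alpha> t0 * s \<tau> * (t0 - \<tau>)\<^sup>2 - \<alpha> t0 * \<alpha> t * (t0 - t)\<^sup>2
            - \<alpha> t * s \<tau> * (\<tau> - t)\<^sup>2 = 0" by blast
    define y' where "y' = cone_hit 0 x (v t)"
    have y'y': "B y' y' = 0" using cone_hit_on_cone[of "v t" x 0] elim v0 by (simp add: y'_def)
    have xy': "B (x - y') (x - y') = 0" using cone_hit_on_line[of "v t" x 0 0] v0 by (simp add: y'_def)
    have "z \<tau> - y' = (\<alpha> t0 *\<^sub>R v t0 + s \<tau> *\<^sub>R v \<tau>) - \<alpha> t *\<^sub>R v t"
      by (simp add: z_def y_def y'_def hit)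
    hence "B (z \<tau> - y') (z \<tau> - y') = 2 * B p r * (\<alpha> t0 * s \<tau> * (t0 - \<tau>)\<^sup>2
        - \<alpha> t0 * \<alpha> t * (t0 - t)\<^sup>2 - \<alpha> t * s \<tau> * (\<tau> - t)\<^sup>2)"
      by (simp only: B_diff B_add) (simp add: expand vv algebra_simps)
    hence zy': "B (z \<tau> - y') (z \<tau> - y') = 0" using eq by simp
    have "B (z \<tau> - y) (z \<tau> - y) = 0" using v0 by (simp add: z_def expand)
    thus ?case using phi_eq_via_common_point[OF x yy xy y'y' xy' zb _ zy'] \<tau>
      unfolding y_def y'_def I_def by auto
  qed
qed

text \<open>The last condition says that the line through \<open>x\<close> in direction \<open>p\<close> does not meet the cone of \<open>0\<close>
  on the line spanned by \<open>b\<close>.\<close>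

definition generic_direction :: "'a \<Rightarrow> 'a \<Rightarrow> bool" where
  "generic_direction x p \<longleftrightarrow> B p p = 0 \<and> B x p \<noteq> 0 \<and> B (x - b) p \<noteq> 0 \<and> B b p \<noteq> 0
     \<and> B ((2 * B x b) *\<^sub>R x - B x x *\<^sub>R b) p \<noteq> 0"

lemma cone_hit_not_orthogonal_b:
  assumes "B x v \<noteq> 0" "B ((2 * B x b) *\<^sub>R x - B x x *\<^sub>R b) v \<noteq> 0"
  shows "B (cone_hit 0 x v) b \<noteq> 0"
proof -
  have "2 * B x v * B (cone_hit 0 x v) b = B ((2 * B x b) *\<^sub>R x - B x x *\<^sub>R b) v"
    using assms(1) sym[of v b] by (simp add: cone_hit_def expand field_simps)
  thus ?thesis using assms by auto
qed

text \<open>An arc joins the two directions; the image of the hit varies continuously along it and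
  is locally constant off finitely many parameters.\<close>

lemma phi_cone_hit_constant:
  assumes x: "B (\<phi> x) (\<phi> x) \<noteq> 0" and p: "generic_direction x p" and r0: "generic_direction x r0"
  shows "\<phi> (cone_hit 0 x p) = \<phi> (cone_hit 0 x r0)"
proof (cases "B p r0 = 0")
  case True
  have "p \<noteq> 0" "r0 \<noteq> 0" using p r0 by (auto simp: generic_direction_def expand)
  moreover obtain c where c: "r0 = c *\<^sub>R p"
    using null_orthogonal_parallel True p r0 \<open>p \<noteq> 0\<close> unfolding generic_direction_def by metis
  ultimately show ?thesis using cone_hit_parallel by auto
next
  case False
  \<comment> \<open>A frame needs a positive product, and rescaling a direction does not move its
    hit.\<close>
  define r where "r = sgn (B p r0) *\<^sub>R r0"
  have sg: "sgn (B p r0) \<noteq> 0" using False by (simp add: sgn_eq_0_iff)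
  have hit_r: "cone_hit 0 x r = cone_hit 0 x r0" unfolding r_def by (rule cone_hit_parallel[OF sg])
  have r: "generic_direction x r"
    using r0 sg unfolding generic_direction_def r_def
    by (simp add: bilinear_lmul[OF bil] bilinear_rmul[OF bil])
  have "B p r = \<bar>B p r0\<bar>" by (simp add: r_def bilinear_rmul[OF bil] abs_sgn mult.commute)
  hence pr: "B p r > 0" using False by simp
  obtain e where fr: "arc_frame p e r" and be: "0 \<le> B b r * B b e"
    using arc_frame_exists p r pr unfolding generic_direction_def by metis
  define v where "v = null_arc p e r"
  have v0: "B (v t) (v t) = 0" for t unfolding v_def by (rule null_arc_null[OF fr])
  have contv: "continuous_on S v" for S unfolding v_def by (intro continuous_intros)
  \<comment> \<open>The arc avoids the direction of \<open>b\<close>, so the null line through \<open>x\<close> never misses both cones.\<close>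
  have bv: "B b (v t) \<noteq> 0" if "t \<in> {0..1}" for t
  proof (cases "t = 0")
    case True thus ?thesis using p by (simp add: v_def generic_direction_def)
  next
    case False
    have "B p r * (B b p * B b r) \<ge> 0"
      using null_triple_product_nonneg[of p r b] p r b_null sym[of b p] sym[of b r]
      by (simp add: generic_direction_def mult.assoc)
    hence "B b p * B b r \<ge> 0" using pr by (simp add: zero_le_mult_iff)
    thus ?thesis using null_arc_same_sign_nonzero[of b p r e t] be that False r
      by (simp add: v_def generic_direction_def)
  qed
  define U where "U = {t. B x (v t) \<noteq> 0}"
  define U' where "U' = {t. B (x - b) (v t) \<noteq> 0}"
  \<comment> \<open>Where the line misses the cone of \<open>0\<close>, its hit on the cone of
    \<open>b\<close> takes over; the two formulas agree on \<open>U \<inter> U'\<close>.\<close>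
  define g where "g t = (if t \<in> U then \<phi> (cone_hit 0 x (v t)) else \<phi> (cone_hit b x (v t)))" for t
  have g': "g t = \<phi> (cone_hit b x (v t))" if "t \<in> U'" for t
    using that phi_cone_hit_eq[OF x v0] by (auto simp: g_def U_def U'_def)
  have op: "open U" "open U'" unfolding U_def U'_def by (intro open_Collect_neq continuous_intros contv)+
  have "continuous_on U (\<lambda>t. \<phi> (cone_hit 0 x (v t)))"
    unfolding v_def by (intro continuous_intros continuous_on_cone_hit_arc) (simp add: U_def v_def)
  hence "continuous_on U g" by (rule continuous_on_eq) (simp add: g_def)
  moreover have "continuous_on U' (\<lambda>t. \<phi> (cone_hit b x (v t)))"
    unfolding v_def by (intro continuous_intros continuous_on_cone_hit_arc) (simp add: U'_def v_def)
  hence "continuous_on U' g" by (rule continuous_on_eq) (simp add: g')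
  ultimately have "continuous_on (U \<union> U') g" using op by (intro continuous_on_open_Un)
  moreover have "{0..1} \<subseteq> U \<union> U'" using bv by (auto simp: U_def U'_def bilinear_lsub[OF bil])
  ultimately have contg: "continuous_on {0..1} g" by (rule continuous_on_subset)
  define d where "d = (2 * B x b) *\<^sub>R x - B x x *\<^sub>R b"
  \<comment> \<open>Each of the three sets is the zero set of a polynomial in \<open>t\<close> whose
    value at \<open>0\<close> is nonzero because \<open>p\<close> is generic.\<close>
  define K where "K = - U \<union> - U' \<union> {t. B d (v t) = 0}"
  have finK: "finite K"
    using p null_arc_roots_finite[of _ p e r]
    by (simp add: K_def U_def U'_def v_def d_def generic_direction_def Collect_neg_eq[symmetric])
  have der: "(g has_derivative (\<lambda>h. 0)) (at t0 within {0..1})" if t0: "t0 \<in> {0..1} - K" for t0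
  proof -
    have t: "t0 \<in> U" "t0 \<in> U'" "B d (v t0) \<noteq> 0" using t0 by (auto simp: K_def)
    have "\<forall>\<^sub>F t in at t0. \<phi> (cone_hit 0 x (v t)) = \<phi> (cone_hit 0 x (v t0))"
      using t cone_hit_not_orthogonal_b[of x "v t0"] unfolding v_def
      by (intro phi_cone_hit_arc_locally_constant[OF fr x]) (auto simp: U_def U'_def d_def v_def)
    moreover have "\<forall>\<^sub>F t in at t0. t \<in> U" using op t by (auto simp: eventually_at_topological)
    ultimately have "\<forall>\<^sub>F t in at t0. g t0 = g t"
      by eventually_elim (use t in \<open>simp add: g_def\<close>)
    hence "(g has_derivative (\<lambda>h. 0)) (at t0)"
      by (intro has_derivative_transform_eventually[OF has_derivative_const]) auto
    thus ?thesis by (rule has_derivative_at_withinI)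
  qed
  have "g 1 = g 0"
    by (rule has_derivative_zero_unique_strong_interval[OF finK contg refl der]) simp_all
  moreover have "0 \<in> U" "1 \<in> U" using p r by (auto simp: U_def v_def generic_direction_def)
  ultimately show ?thesis using hit_r by (simp add: g_def v_def)
qed

text \<open>Four applications of \<open>null_dense\<close>, each inside the open set left by the
  previous ones.\<close>

lemma generic_direction_dense:
  assumes x: "B (\<phi> x) (\<phi> x) \<noteq> 0" and "open U" "v \<in> U" "B v v = 0"
  obtains p where "p \<in> U" "generic_direction x p"
proof -
  have xx: "B x x \<noteq> 0" using x phi_null by blast
  have "x \<noteq> 0" "x - b \<noteq> 0" using x phi_0 phi_b by (auto simp: expand)
  define d where "d = (2 * B x b) *\<^sub>R x - B x x *\<^sub>R b"
  have "d \<noteq> 0"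
  proof
    assume "d = 0"
    hence *: "(2 * B x b) *\<^sub>R x = B x x *\<^sub>R b" by (simp add: d_def)
    hence "B b ((2 * B x b) *\<^sub>R x) = B b (B x x *\<^sub>R b)" by simp
    hence "B x b = 0" using b_null sym[of b x] by (simp add: bilinear_rmul[OF bil])
    thus False using * xx b_nz by simp
  qed
  have op: "open {u. B a u \<noteq> 0}" for a by (intro open_Collect_neq continuous_intros)
  obtain v1 where v1: "v1 \<in> U" "B v1 v1 = 0" "B x v1 \<noteq> 0"
    using null_dense assms \<open>x \<noteq> 0\<close> by metis
  obtain v2 where v2: "v2 \<in> U \<inter> {u. B x u \<noteq> 0}" "B v2 v2 = 0" "B (x - b) v2 \<noteq> 0"
    using null_dense[OF open_Int[OF assms(2) op] _ v1(2) \<open>x - b \<noteq> 0\<close>] v1 by blast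
  obtain v3 where v3: "v3 \<in> (U \<inter> {u. B x u \<noteq> 0}) \<inter> {u. B (x - b) u \<noteq> 0}" "B v3 v3 = 0" "B b v3 \<noteq> 0"
    using null_dense[OF open_Int[OF open_Int[OF assms(2) op] op] _ v2(2) b_nz] v2 by blast
  obtain v4 where "v4 \<in> ((U \<inter> {u. B x u \<noteq> 0}) \<inter> {u. B (x - b) u \<noteq> 0}) \<inter> {u. B b u \<noteq> 0}"
    "B v4 v4 = 0" "B d v4 \<noteq> 0"
    using null_dense[OF open_Int[OF open_Int[OF open_Int[OF assms(2) op] op] op] _ v3(2) \<open>d \<noteq> 0\<close>] v3 by blast
  thus ?thesis using that[of v4] by (simp add: generic_direction_def d_def)
qed

section \<open>From one cone to the whole range\<close>

text \<open>\<open>w\<close> is the common image of all generic hits. Points \<open>x + v\<close>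
  with \<open>v\<close> generic are coherent to such a hit, and density extends the conclusion to
  the whole cone of \<open>x\<close>.\<close>

lemma cone_image_in_line:
  assumes x: "B (\<phi> x) (\<phi> x) \<noteq> 0"
  obtains w where "\<And>z. B (x - z) (x - z) = 0 \<Longrightarrow> B (\<phi> z - w) (\<phi> z - w) = 0"
    and "\<And>z. B (x - z) (x - z) = 0 \<Longrightarrow> B (\<phi> z) (\<phi> z) = 0 \<Longrightarrow> \<phi> z = w"
proof -
  obtain p where p: "generic_direction x p"
    using generic_direction_dense[OF x open_UNIV, of 0] by (auto simp: expand)
  define w where "w = \<phi> (cone_hit 0 x p)"
  have w0: "B w w = 0"
    using p cone_hit_on_cone[of p x 0] by (auto simp: w_def generic_direction_def intro: phi_null)
  have one: "B (\<phi> z - w) (\<phi> z - w) = 0" if "B (x - z) (x - z) = 0" for z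
  proof (rule ccontr)
    assume ne: "B (\<phi> z - w) (\<phi> z - w) \<noteq> 0"
    define U where "U = {u. B (\<phi> (x + u) - w) (\<phi> (x + u) - w) \<noteq> 0}"
    have "open U" unfolding U_def by (intro open_Collect_neq continuous_intros)
    moreover have "z - x \<in> U" using ne by (simp add: U_def)
    moreover have "B (z - x) (z - x) = 0" using that B_diff_commute by metis
    ultimately obtain v where v: "v \<in> U" "generic_direction x v"
      using generic_direction_dense[OF x] by blast
    have "w = \<phi> (cone_hit 0 x v)" unfolding w_def by (rule phi_cone_hit_constant[OF x p v(2)])
    moreover have "B (x + v - cone_hit 0 x v) (x + v - cone_hit 0 x v) = 0"
      using cone_hit_on_line[of v x 1 0] v(2) by (simp add: generic_direction_def)
    ultimately have "B (\<phi> (x + v) - w) (\<phi> (x + v) - w) = 0" using pres by blast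
    thus False using v(1) by (simp add: U_def)
  qed
  have "\<phi> z = w" if "B (x - z) (x - z) = 0" "B (\<phi> z) (\<phi> z) = 0" for z
  proof (rule null_line_meets_cone_once[OF x that(2) w0 pres[OF that(1)] _ one[OF that(1)]])
    show "B (\<phi> x - w) (\<phi> x - w) = 0" by (rule one) (simp add: expand)
  qed
  with one show ?thesis by (rule that)
qed

text \<open>A null line through \<open>x\<close> meets the cone of an arbitrary \<open>x'\<close> in
  \<open>y\<close> and that of \<open>0\<close> in \<open>y0\<close>. Either
  \<open>\<phi> y = w\<close>, or \<open>cone_image_in_line\<close> applies at \<open>y\<close> as
  well.\<close>

lemma range_in_cone: "\<exists>w. \<forall>x. B (\<phi> x - w) (\<phi> x - w) = 0"
proof (cases "\<forall>x. B (\<phi> x) (\<phi> x) = 0")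
  case True
  thus ?thesis by (intro exI[of _ 0]) simp
next
  case False
  then obtain x where x: "B (\<phi> x) (\<phi> x) \<noteq> 0" by blast
  hence "x \<noteq> 0" using phi_0 by (auto simp: expand)
  obtain w where w: "\<And>z. B (x - z) (x - z) = 0 \<Longrightarrow> B (\<phi> z - w) (\<phi> z - w) = 0"
    "\<And>z. B (x - z) (x - z) = 0 \<Longrightarrow> B (\<phi> z) (\<phi> z) = 0 \<Longrightarrow> \<phi> z = w"
    using cone_image_in_line[OF x] by blast
  have "B (\<phi> x' - w) (\<phi> x' - w) = 0" for x'
  proof (cases "B (x - x') (x - x') = 0")
    case True
    thus ?thesis by (rule w(1))
  next
    case ne: False
    hence "x - x' \<noteq> 0" by (auto simp: expand)
    then obtain r' where r': "B r' r' = 0" "B (x - x') r' \<noteq> 0"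
      using null_not_orthogonal_exists by blast
    moreover have "open {u. B (x - x') u \<noteq> 0}" by (intro open_Collect_neq continuous_intros)
    ultimately obtain r where r: "B (x - x') r \<noteq> 0" "B r r = 0" "B x r \<noteq> 0"
      using null_dense[of "{u. B (x - x') u \<noteq> 0}" r' x] \<open>x \<noteq> 0\<close> by blast
    define y where "y = cone_hit x' x r"
    define y0 where "y0 = cone_hit 0 x r"
    have yx': "B (y - x') (y - x') = 0" unfolding y_def by (rule cone_hit_on_cone[OF r(2,1)])
    have xy: "B (x - y) (x - y) = 0" using cone_hit_on_line[OF r(2), of x 0] by (simp add: y_def)
    show ?thesis
    proof (cases "B (\<phi> y) (\<phi> y) = 0")
      case True
      hence "\<phi> y = w" using w(2) xy by blast
      thus ?thesis using pres[OF yx'] B_diff_commute by metis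
    next
      case False
      then obtain w' where w': "\<And>z. B (y - z) (y - z) = 0 \<Longrightarrow> B (\<phi> z - w') (\<phi> z - w') = 0"
        "\<And>z. B (y - z) (y - z) = 0 \<Longrightarrow> B (\<phi> z) (\<phi> z) = 0 \<Longrightarrow> \<phi> z = w'"
        using cone_image_in_line[OF False] by blast
      have "B (\<phi> y0) (\<phi> y0) = 0"
        using cone_hit_on_cone[OF r(2), of x 0] r(3) by (intro phi_null) (simp add: y0_def)
      moreover have "B (x - y0) (x - y0) = 0" using cone_hit_on_line[OF r(2), of x 0] by (simp add: y0_def)
      moreover have "B (y - y0) (y - y0) = 0"
        using cone_hit_on_line[OF r(2), of x "- (B (x - x') (x - x') / (2 * B (x - x') r))" 0]
        by (simp add: y_def y0_def cone_hit_def)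
      \<comment> \<open>\<open>y0\<close> lies on the cones of both \<open>x\<close> and
        \<open>y\<close> and has a null image, so \<open>w = \<phi> y0 = w'\<close>.\<close>
      ultimately have "w' = w" using w(2) w'(2) by metis
      thus ?thesis using w'(1)[OF yx'] by simp
    qed
  qed
  thus ?thesis by blast
qed

end

section \<open>From Minkowski spaces to Lorentz forms\<close>

lemma minkowski_space_lorentz_form:
  fixes q :: "'a::euclidean_space \<Rightarrow> real"
  assumes "minkowski_space q" "2 < DIM('a)"
  obtains B e0 where "lorentz_form B e0" "\<And>x. q x = B x x"
proof -
  let ?n = "DIM('a)"
  obtain B where B: "bilinear B" "\<And>x y. B x y = B y x" "\<And>x. q x = B x x"
    using assms(1) unfolding minkowski_space_def quadratic_form_def by blast
  obtain e :: "nat \<Rightarrow> 'a" where e: "inj_on e {..<?n}" "span (e ` {..<?n}) = UNIV"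
    "\<And>c. q (\<Sum>i<?n. c i *\<^sub>R e i) = (c 0)\<^sup>2 - (\<Sum>i\<in>{1..<?n}. (c i)\<^sup>2)"
    using assms(1) unfolding minkowski_space_def has_signature_1_nm1_def by metis
  have unit: "q (e 0) = 1"
  proof -
    have "(\<Sum>i<?n. (if i = 0 then 1 else 0) *\<^sub>R e i) = (\<Sum>i<?n. if i = 0 then e 0 else 0)"
      by (rule sum.cong) auto
    also have "\<dots> = e 0" by simp
    finally show ?thesis using e(3)[of "\<lambda>i. if i = 0 then 1 else 0"] by simp
  qed
  have coords: "\<exists>c. x = (\<Sum>i<?n. c i *\<^sub>R e i)" for x
  proof -
    have "x \<in> span (e ` {..<?n})" using e(2) by simp
    then obtain u where "x = (\<Sum>v\<in>e ` {..<?n}. u v *\<^sub>R v)" by (auto simp: span_finite)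
    thus ?thesis using e(1) by (auto simp: sum.reindex intro!: exI[of _ "u \<circ> e"])
  qed
  have "B x x < 0" if x: "B (e 0) x = 0" "x \<noteq> 0" for x
  proof -
    obtain c where c: "x = (\<Sum>i<?n. c i *\<^sub>R e i)" using coords by blast
    define S where "S = (\<Sum>i\<in>{1..<?n}. (c i)\<^sup>2)"
    have qx: "q x = (c 0)\<^sup>2 - S" unfolding c S_def by (rule e(3))
    have "(\<Sum>i<?n. (c(0 := c 0 + 1)) i *\<^sub>R e i) = (\<Sum>i<?n. c i *\<^sub>R e i + (if i = 0 then e 0 else 0))"
      by (rule sum.cong) (auto simp: algebra_simps)
    also have "\<dots> = x + e 0" by (simp add: sum.distrib c)
    finally have "q (x + e 0) = (c 0 + 1)\<^sup>2 - S"
      using e(3)[of "c(0 := c 0 + 1)"] by (simp add: S_def)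
    \<comment> \<open>Comparing this expansion with the one in coordinates shows that a vector
      orthogonal to \<open>e 0\<close> has \<open>c 0 = 0\<close>.\<close>
    moreover have "q (x + e 0) = q x + 1"
      using x(1) unit B(2)[of x "e 0"] by (simp add: B(3) bilinear_ladd[OF B(1)] bilinear_radd[OF B(1)])
    ultimately have c0: "c 0 = 0" using qx by (simp add: power2_eq_square algebra_simps)
    have "S \<noteq> 0"
    proof
      assume "S = 0"
      hence "\<forall>i\<in>{1..<?n}. c i = 0" unfolding S_def by (subst (asm) sum_nonneg_eq_0_iff) auto
      hence "c i = 0" if "i < ?n" for i using c0 that by (cases "i = 0") auto
      hence "x = 0" unfolding c by simp
      thus False using x(2) by simp
    qed
    moreover have "S \<ge> 0" unfolding S_def by (intro sum_nonneg) simp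
    ultimately show ?thesis using qx c0 B(3)[of x] by simp
  qed
  hence "lorentz_form B (e 0)" using B unit assms(2) by unfold_locales auto
  thus ?thesis using that B(3) by blast
qed

theorem theorem1p4:
  fixes q :: "'a::euclidean_space \<Rightarrow> real" and \<phi> :: "'a \<Rightarrow> 'a"
  assumes "minkowski_space q"
    and "DIM('a) > 3"
    and "continuous_on UNIV \<phi>"
    and "coherency_preserver q \<phi>"
  shows "preserves_adjacency q \<phi> \<or> degenerate q \<phi>"
proof (cases "preserves_adjacency q \<phi>")
  case False
  obtain B e0 where "lorentz_form B e0" and q: "\<And>x. q x = B x x"
    by (rule minkowski_space_lorentz_form[OF assms(1)]) (use assms(2) in simp_all)
  interpret lorentz_form B e0 by fact
  \<comment> \<open>A coherency preserver can fail to preserve adjacency only by identifying two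
    adjacent points.\<close>
  obtain a c where ac: "q (a - c) = 0" "a \<noteq> c" "\<phi> a = \<phi> c"
    using False assms(4)
    unfolding preserves_adjacency_def adjacent_def coherent_def coherency_preserver_def by blast
  \<comment> \<open>Translations in source and target move the collapsed pair to \<open>0\<close>
    and \<open>c - a\<close>, with common image \<open>0\<close>.\<close>
  define \<psi> where "\<psi> x = \<phi> (x + a) - \<phi> a" for x
  interpret collapsing_preserver B e0 \<psi> "c - a"
  proof
    show "continuous_on UNIV \<psi>" unfolding \<psi>_def
      by (intro continuous_intros continuous_on_compose2[OF assms(3)]) auto
    show "B (\<psi> x - \<psi> y) (\<psi> x - \<psi> y) = 0" if "B (x - y) (x - y) = 0" for x y
    proof -
      have "q ((x + a) - (y + a)) = 0" using that q by simp
      hence "q (\<phi> (x + a) - \<phi> (y + a)) = 0"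
        using assms(4) unfolding coherency_preserver_def coherent_def by blast
      thus ?thesis by (simp add: \<psi>_def q)
    qed
    show "B (c - a) (c - a) = 0" using ac(1) B_diff_commute q by metis
  qed (use ac in \<open>auto simp: \<psi>_def\<close>)
  obtain w where w: "\<And>x. B (\<psi> x - w) (\<psi> x - w) = 0" using range_in_cone by blast
  have "q (\<phi> x - (\<phi> a + w)) = 0" for x
    using w[of "x - a"] by (simp add: \<psi>_def q algebra_simps)
  hence "degenerate q \<phi>" unfolding degenerate_def coherency_cone_def by blast
  thus ?thesis ..
qed simp

end
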